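(* Let $n$ be a congruent number. Then there exist a nonzero rational $q$ and a right triangle with rational side lengths and area $q^2 n$ whose $a$-, $b$-, or $c$-excircle has radius $1$.
   Context: A congruent number is a positive integer (or positive rational) that is the area of a right triangle with rational side lengths. For a right triangle with legs $a=BC$, $b=CA$ and hypotenuse $c=AB$, the $a$-, $b$-, $c$-excircles are the circles tangent to the sides $BC$, $CA$, $AB$ respectively and to the extensions of the other two sides. *)

theory Defs
  imports "HOL-Analysis.Analysis"
begin

text \<open>Triangles are given by their vertices in the Euclidean plane. A right triangle has its
  right angle at the third vertex \<open>C\<close>, so the legs are \<open>a = BC\<close>, \<open>b = CA\<close> and the hypotenuse
  is \<open>c = AB\<close>.\<close>

definition right_triangle :: "real^2 \<Rightarrow> real^2 \<Rightarrow> real^2 \<Rightarrow> bool" where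
  "right_triangle A B C \<longleftrightarrow> \<not> collinear {A, B, C} \<and> orthogonal (A - C) (B - C)"

definition rational_sides :: "real^2 \<Rightarrow> real^2 \<Rightarrow> real^2 \<Rightarrow> bool" where
  "rational_sides A B C \<longleftrightarrow> dist B C \<in> \<rat> \<and> dist C A \<in> \<rat> \<and> dist A B \<in> \<rat>"

definition triangle_area :: "real^2 \<Rightarrow> real^2 \<Rightarrow> real^2 \<Rightarrow> real" where
  "triangle_area A B C = measure lborel (convex hull {A, B, C})"

text \<open>Congruent numbers are taken in the wider sense, as positive rationals.\<close>

definition congruent_number :: "rat \<Rightarrow> bool" where
  "congruent_number n \<longleftrightarrow> 0 < n \<and>
     (\<exists>A B C. right_triangle A B C \<and> rational_sides A B C \<and> triangle_area A B C = of_rat n)"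

definition tangent_at :: "real^2 \<Rightarrow> real \<Rightarrow> (real^2) set \<Rightarrow> real^2 \<Rightarrow> bool" where
  "tangent_at J r L P \<longleftrightarrow> sphere J r \<inter> L = {P}"

text \<open>A circle is tangent to the side \<open>XY\<close> if it is tangent to the line \<open>XY\<close> at a point of the
  segment, and tangent to an extension of the side if the point of tangency lies on the
  line outside the segment.\<close>

definition tangent_to_side :: "real^2 \<Rightarrow> real \<Rightarrow> real^2 \<Rightarrow> real^2 \<Rightarrow> bool" where
  "tangent_to_side J r X Y \<longleftrightarrow>
     (\<exists>P \<in> closed_segment X Y. tangent_at J r (affine hull {X, Y}) P)"

definition tangent_to_extension :: "real^2 \<Rightarrow> real \<Rightarrow> real^2 \<Rightarrow> real^2 \<Rightarrow> bool" where
  "tangent_to_extension J r X Y \<longleftrightarrow>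
     (\<exists>P \<in> affine hull {X, Y} - closed_segment X Y. tangent_at J r (affine hull {X, Y}) P)"

text \<open>The circle with centre \<open>J\<close> and radius \<open>r\<close> is the excircle of the triangle opposite
  its first vertex \<open>X\<close>. Positivity of \<open>r\<close> excludes one-point circles, which meet every
  line through their centre in a single point.\<close>

definition excircle_opposite ::
    "real^2 \<Rightarrow> real^2 \<Rightarrow> real^2 \<Rightarrow> real^2 \<Rightarrow> real \<Rightarrow> bool" where
  "excircle_opposite X Y Z J r \<longleftrightarrow> 0 < r \<and> tangent_to_side J r Y Z \<and>
     tangent_to_extension J r Z X \<and> tangent_to_extension J r X Y"

definition a_excircle :: "real^2 \<Rightarrow> real^2 \<Rightarrow> real^2 \<Rightarrow> real^2 \<Rightarrow> real \<Rightarrow> bool" where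
  "a_excircle A B C = excircle_opposite A B C"

definition b_excircle :: "real^2 \<Rightarrow> real^2 \<Rightarrow> real^2 \<Rightarrow> real^2 \<Rightarrow> real \<Rightarrow> bool" where
  "b_excircle A B C = excircle_opposite B C A"

definition c_excircle :: "real^2 \<Rightarrow> real^2 \<Rightarrow> real^2 \<Rightarrow> real^2 \<Rightarrow> real \<Rightarrow> bool" where
  "c_excircle A B C = excircle_opposite C A B"

end

theory Submission
  imports Defs
begin

text \<open>The radius of the excircle opposite the right angle is half the perimeter, hence rational.
  Scaling a rational right triangle of area \<open>n\<close> by its inverse \<open>q\<close> gives a rational right
  triangle of area \<open>q\<^sup>2 n\<close> with that radius equal to \<open>1\<close>.\<close>

text \<open>For any \<open>Q\<close> on the line, Pythagoras in the triangle \<open>J\<close>,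
  \<open>P\<close>, \<open>Q\<close> gives \<open>|JQ|^2 = |JP|^2 + |PQ|^2\<close>. If
  \<open>Q\<close> also lies on the circle, both distances from \<open>J\<close> are
  \<open>r\<close>, which forces \<open>P = Q\<close>.\<close>

lemma tangent_atI:
  assumes P: "P \<in> affine hull {X, Y}" and "dist J P = r" and orth: "(J - P) \<bullet> (Y - X) = 0"
  shows "tangent_at J r (affine hull {X, Y}) P"
  unfolding tangent_at_def
proof (intro equalityI subsetI)
  fix Q assume Q: "Q \<in> sphere J r \<inter> affine hull {X, Y}"
  have on_line: "\<exists>s. R = X + s *\<^sub>R (Y - X)" if "R \<in> affine hull {X, Y}" for R
    using that by (force simp: affine_hull_2_alt)
  obtain s where s: "P = X + s *\<^sub>R (Y - X)"
    using on_line P by blast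
  obtain t where t: "Q = X + t *\<^sub>R (Y - X)"
    using on_line Q by blast
  have PQ: "P - Q = (s - t) *\<^sub>R (Y - X)"
    unfolding s t by (simp add: algebra_simps)
  have "(J - P) \<bullet> (P - Q) = 0"
    using orth by (simp add: PQ)
  then have "(norm ((J - P) + (P - Q)))\<^sup>2 = (norm (J - P))\<^sup>2 + (norm (P - Q))\<^sup>2"
    by (intro norm_add_Pythagorean) (simp add: orthogonal_def)
  moreover have "norm (J - P) = r" "norm (J - Q) = r"
    using assms(2) Q by (auto simp: dist_norm)
  ultimately show "Q \<in> {P}" by simp
qed (use assms in auto)

lemma right_triangle_pythagoras:
  assumes "right_triangle A B C"
  shows "(dist A B)\<^sup>2 = (dist B C)\<^sup>2 + (dist C A)\<^sup>2"
proof -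
  have "orthogonal (A - C) (- (B - C))"
    using assms unfolding right_triangle_def orthogonal_def inner_minus_right by simp
  from norm_add_Pythagorean[OF this] show ?thesis
    by (simp add: dist_norm norm_minus_commute[of C])
qed

lemma right_triangle_pos:
  assumes "right_triangle A B C"
  shows "0 < dist B C" "0 < dist C A" "0 < dist A B"
  using assms by (auto simp: right_triangle_def insert_commute)

text \<open>\<open>P\<close> is the point of the ray from \<open>C\<close> through \<open>A\<close>
  at distance \<open>r\<close> from \<open>C\<close>. Points of the segment are at most
  \<open>dist C A\<close> away from \<open>C\<close>, so \<open>P\<close> lies beyond
  \<open>A\<close>. It serves as the touch point on an extended leg.\<close>

lemma leg_extension:
  fixes C A :: "real^2"
  assumes "C \<noteq> A" and r: "dist C A < r"
  defines "P \<equiv> C + (r / dist C A) *\<^sub>R (A - C)"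
  shows "P \<in> affine hull {C, A}" "P \<notin> closed_segment C A"
proof -
  show "P \<in> affine hull {C, A}"
    unfolding P_def affine_hull_2_alt by auto
  have "0 < r" using r by (meson le_less_trans zero_le_dist)
  then have "dist C P = r"
    using \<open>C \<noteq> A\<close> by (simp add: P_def dist_norm norm_minus_commute)
  then show "P \<notin> closed_segment C A"
    using r dist_in_closed_segment[of P C A] by (auto simp: dist_commute)
qed

text \<open>The centre and the two touch points on the legs' lines form a square with corner
  \<open>C\<close> and side \<open>r\<close>. With \<open>r\<close> the half-perimeter, this circle
  also touches the hypotenuse, which is checked in coordinates along the orthogonal legs
  \<open>u\<close> and \<open>v\<close>.\<close>

lemma c_excircle_half_perimeter:
  assumes rt: "right_triangle A B C"
  shows "\<exists>J. c_excircle A B C J ((dist B C + dist C A + dist A B) / 2)"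
proof -
  define a b c where abc: "a = dist B C" "b = dist C A" "c = dist A B"
  define r where "r = (a + b + c) / 2"
  define u v where uv: "u = A - C" "v = B - C"
  \<comment> \<open>The corner opposite \<open>C\<close> in the square of side \<open>r\<close>,
    since \<open>u\<close> has length \<open>b\<close> and \<open>v\<close> has length
    \<open>a\<close>.\<close>
  define J where "J = C + (r / b) *\<^sub>R u + (r / a) *\<^sub>R v"
  \<comment> \<open>The touch point on the line \<open>CA\<close> is at distance
    \<open>r - b\<close> from \<open>A\<close>. The two tangent lengths from \<open>A\<close> agree,
    so the touch point \<open>T\<close> on the hypotenuse is also that far from
    \<open>A\<close>.\<close>
  define t where "t = (r - b) / c"
  define T where "T = A + t *\<^sub>R (B - A)"
  have pos: "0 < a" "0 < b" "0 < c" and pyth: "c\<^sup>2 = a\<^sup>2 + b\<^sup>2"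
    using right_triangle_pos[OF rt] right_triangle_pythagoras[OF rt] by (auto simp: abc)
  \<comment> \<open>The resulting inequalities locate the touch points: \<open>a < r\<close> and
    \<open>b < r\<close> put two of them beyond \<open>B\<close> and \<open>A\<close>, and
    \<open>0 \<le> r - b \<le> c\<close> keeps \<open>T\<close> on the hypotenuse.\<close>
  have "a\<^sup>2 < c\<^sup>2" "b\<^sup>2 < c\<^sup>2" "c\<^sup>2 < (a + b)\<^sup>2"
    using pos by (simp_all add: pyth power2_sum)
  then have "a < c" "b < c" "c < a + b"
    using pos by (auto intro: power2_less_imp_less)
  moreover have r2: "2 * r = a + b + c"
    by (simp add: r_def)
  ultimately have r: "0 < r" "a < r" "b < r" and "0 \<le> r - b" "r - b \<le> c"
    using pos by linarith+
  then have t: "0 \<le> t" "t \<le> 1"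
    using pos by (simp_all add: t_def)
  have orth: "u \<bullet> v = 0" "v \<bullet> u = 0"
    using rt by (auto simp: uv right_triangle_def orthogonal_def inner_commute)
  have len: "norm u = b" "norm v = a"
    by (simp_all add: uv abc dist_norm norm_minus_commute)
  then have sq: "u \<bullet> u = b\<^sup>2" "v \<bullet> v = a\<^sup>2"
    by (simp_all add: dot_square_norm)
  have tc: "t * c = r - b"
    using pos by (simp add: t_def)
  have JT: "J - T = (r / b - 1 + t) *\<^sub>R u + (r / a - t) *\<^sub>R v"
    by (simp add: J_def T_def uv algebra_simps)
  have side: "tangent_to_side J r A B"
    unfolding tangent_to_side_def
  proof (intro bexI tangent_atI)
    show "T \<in> closed_segment A B"
      using t unfolding T_def closed_segment_def by (auto simp: algebra_simps intro!: exI[of _ t])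
    show "T \<in> affine hull {A, B}"
      unfolding T_def affine_hull_2_alt by auto
    have "(J - T) \<bullet> (J - T) = (r - b + t * b)\<^sup>2 + (r - t * a)\<^sup>2"
      using pos by (simp add: JT inner_add_left inner_add_right orth sq)
        (simp add: field_simps power2_eq_square)
    also have "\<dots> = r\<^sup>2"
    proof -
      \<comment> \<open>By \<open>t * c = r - b\<close> the first square above is
        \<open>t\<^sup>2 * (b + c)\<^sup>2\<close>, so the sum equals \<open>r\<^sup>2\<close> once
        \<open>t * ((b + c)\<^sup>2 + a\<^sup>2) = 2 * r * a\<close>. The factor \<open>c\<close>
        makes this polynomial in \<open>t * c\<close>.\<close>
      have "c * (t * ((b + c)\<^sup>2 + a\<^sup>2)) = c * (2 * r * a)"
        using tc pyth r2 by algebra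
      then have "t * ((b + c)\<^sup>2 + a\<^sup>2) = 2 * r * a"
        using pos by simp
      then show ?thesis using tc by algebra
    qed
    finally show "dist J T = r"
      using r by (simp add: dist_norm norm_eq_sqrt_inner)
    have "(J - T) \<bullet> (B - A) = (J - T) \<bullet> (v - u)"
      by (simp add: uv)
    also have "\<dots> = r * (a - b) + b\<^sup>2 - t * (a\<^sup>2 + b\<^sup>2)"
      using pos by (simp add: JT inner_add_left inner_diff_right orth sq)
        (simp add: field_simps power2_eq_square)
    \<comment> \<open>Substituting \<open>t * (a\<^sup>2 + b\<^sup>2) = c * (r - b)\<close> and
      doubling leaves \<open>a\<^sup>2 + b\<^sup>2 - c\<^sup>2\<close>.\<close>
    also have "\<dots> = 0"
      using tc pyth r2 by algebra
    finally show "(J - T) \<bullet> (B - A) = 0" .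
  qed
  have CA: "tangent_to_extension J r C A"
    unfolding tangent_to_extension_def
  proof (intro bexI tangent_atI DiffI)
    \<comment> \<open>The radius to this point is parallel to the other leg, hence perpendicular to
      \<open>CA\<close>, and has length \<open>r\<close>.\<close>
    let ?P = "C + (r / b) *\<^sub>R (A - C)"
    have JP: "J - ?P = (r / a) *\<^sub>R v" by (simp add: J_def uv)
    show "?P \<in> affine hull {C, A}" "?P \<in> affine hull {C, A}" "?P \<notin> closed_segment C A"
      using leg_extension[of C A r] pos r by (auto simp: abc)
    show "dist J ?P = r"
      using pos r by (simp add: dist_norm JP len)
    show "(J - ?P) \<bullet> (A - C) = 0"
      unfolding JP using orth by (simp add: uv)
  qed
  have CB: "tangent_to_extension J r C B"
    unfolding tangent_to_extension_def
  proof (intro bexI tangent_atI DiffI)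
    let ?P = "C + (r / a) *\<^sub>R (B - C)"
    have JP: "J - ?P = (r / b) *\<^sub>R u" by (simp add: J_def uv)
    show "?P \<in> affine hull {C, B}" "?P \<in> affine hull {C, B}" "?P \<notin> closed_segment C B"
      using leg_extension[of C B r] pos r by (auto simp: abc dist_commute)
    show "dist J ?P = r"
      using pos r by (simp add: dist_norm JP len)
    show "(J - ?P) \<bullet> (B - C) = 0"
      unfolding JP using orth by (simp add: uv)
  qed
  have "tangent_to_extension J r B C"
    using CB by (simp add: tangent_to_extension_def insert_commute closed_segment_commute)
  with side CA r have "c_excircle A B C J r"
    by (simp add: c_excircle_def excircle_opposite_def)
  then show ?thesis unfolding r_def abc by blast
qed

text \<open>Collinearity means affine dimension at most 1, which an injective linear map preserves;
  inner products only gain the factor \<open>s\<^sup>2\<close>.\<close>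

lemma right_triangle_scaleR:
  assumes "right_triangle A B C" "s \<noteq> 0"
  shows "right_triangle (s *\<^sub>R A) (s *\<^sub>R B) (s *\<^sub>R C)"
proof -
  have "collinear ((*\<^sub>R) s ` {A, B, C}) = collinear {A, B, C}"
    unfolding collinear_aff_dim using assms(2)
    by (subst aff_dim_injective_linear_image) (auto simp: inj_on_def)
  then show ?thesis
    using assms unfolding right_triangle_def by (auto simp: orthogonal_def simp flip: scaleR_diff_right)
qed

lemma dist_scaleR_scaleR:
  fixes x y :: "'a::real_normed_vector"
  shows "dist (s *\<^sub>R x) (s *\<^sub>R y) = \<bar>s\<bar> * dist x y"
  by (simp add: dist_norm flip: scaleR_diff_right)

lemma triangle_area_scaleR:
  "triangle_area (s *\<^sub>R A) (s *\<^sub>R B) (s *\<^sub>R C) = s\<^sup>2 * triangle_area A B C"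
proof -
  let ?T = "convex hull {A, B, C}"
  \<comment> \<open>The scaling rule concerns Lebesgue measure, which agrees with
    \<open>lborel\<close> on Borel sets; both hulls are compact, hence Borel. The exponent 2 is the
    dimension of the plane.\<close>
  have "?T \<in> sets borel"
    by (intro borel_compact finite_imp_compact_convex_hull) simp
  moreover have image: "convex hull {s *\<^sub>R A, s *\<^sub>R B, s *\<^sub>R C} = (\<lambda>x. s *\<^sub>R x + 0) ` ?T"
    using convex_hull_scaling[of s "{A, B, C}"] by simp
  moreover have "convex hull {s *\<^sub>R A, s *\<^sub>R B, s *\<^sub>R C} \<in> sets borel"
    by (intro borel_compact finite_imp_compact_convex_hull) simp
  ultimately show ?thesis
    using measure_lebesgue_affine[of s 0 ?T] by (simp add: triangle_area_def)
qed

theorem theorem5p3: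
  fixes n :: rat
  assumes "congruent_number n"
  shows "\<exists>(q::rat) A B C. q \<noteq> 0 \<and> right_triangle A B C \<and> rational_sides A B C \<and>
           triangle_area A B C = of_rat (q\<^sup>2 * n) \<and>
           ((\<exists>J. a_excircle A B C J 1) \<or> (\<exists>J. b_excircle A B C J 1) \<or> (\<exists>J. c_excircle A B C J 1))"
proof -
  obtain A B C where rt: "right_triangle A B C" and rat: "rational_sides A B C"
    and area: "triangle_area A B C = of_rat n"
    using assms unfolding congruent_number_def by blast
  define p where "p = (dist B C + dist C A + dist A B) / 2"
  have p: "0 < p"
    unfolding p_def by (intro half_gt_zero add_pos_pos right_triangle_pos[OF rt])
  have "1 / p \<in> \<rat>"
    using rat by (simp add: p_def rational_sides_def)
  then obtain q where q: "1 / p = of_rat q"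
    by (auto elim: Rats_cases)
  define s where "s = 1 / p"
  have s: "0 < s"
    using p by (simp add: s_def)
  have sq: "s = of_rat q" "s \<in> \<rat>"
    unfolding s_def q by simp_all
  have rt': "right_triangle (s *\<^sub>R A) (s *\<^sub>R B) (s *\<^sub>R C)"
    using rt s by (intro right_triangle_scaleR) auto
  \<comment> \<open>The scaled triangle has perimeter 2, so its excircle opposite the right angle
    has radius 1.\<close>
  have "s * dist B C + s * dist C A + s * dist A B = s * (2 * p)"
    by (simp add: p_def algebra_simps)
  also have "\<dots> = 2"
    using p by (simp add: s_def)
  finally have "\<exists>J. c_excircle (s *\<^sub>R A) (s *\<^sub>R B) (s *\<^sub>R C) J 1"
    using c_excircle_half_perimeter[OF rt'] s by (simp add: dist_scaleR_scaleR)
  moreover have "rational_sides (s *\<^sub>R A) (s *\<^sub>R B) (s *\<^sub>R C)"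
    using rat sq(2) by (simp add: rational_sides_def dist_scaleR_scaleR)
  moreover have "triangle_area (s *\<^sub>R A) (s *\<^sub>R B) (s *\<^sub>R C) = of_rat (q\<^sup>2 * n)"
    by (simp add: triangle_area_scaleR area sq(1) of_rat_mult of_rat_power)
  moreover have "q \<noteq> 0" using s sq by auto
  ultimately show ?thesis using rt' by blast
qed

end
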